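(* For each $k \in \mathbb{N}$, every (finite) graph $G$ with list chromatic number $\chi_\ell(G) \ge 4k+1$ contains a subgraph $H$ with both connectivity $\kappa(H) \ge k$ and list chromatic number $\chi_\ell(H) \ge k$.
   Context: $\chi_\ell$ denotes list chromatic number (choosability) and $\kappa$ denotes vertex connectivity. *)

theory Defs
  imports Complex_Main "Graph_Theory.Graph_Theory"
begin

text \<open>
  A finite simple undirected graph is a \<^term>\<open>graph G\<close>: finite, loop-free, without parallel arcs,
  and with a symmetric arc relation, each undirected edge being a pair of opposite arcs.
\<close>

definition proper_coloring :: "('a, 'b) pre_digraph \<Rightarrow> ('a \<Rightarrow> 'c) \<Rightarrow> bool" where
  "proper_coloring G c \<longleftrightarrow> (\<forall>u v. u \<rightarrow>\<^bsub>G\<^esub> v \<longrightarrow> c u \<noteq> c v)"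

text \<open>
  Since only finitely many colors occur in the lists of a finite graph, it is no restriction to
  take all colors from \<^typ>\<open>nat\<close>. The explicit finiteness matters for \<open>n = 0\<close>, as infinite sets
  have \<^const>\<open>card\<close> zero.
\<close>
definition choosable :: "('a, 'b) pre_digraph \<Rightarrow> nat \<Rightarrow> bool" where
  "choosable G n \<longleftrightarrow>
    (\<forall>L :: 'a \<Rightarrow> nat set.
      (\<forall>v \<in> verts G. finite (L v) \<and> card (L v) = n) \<longrightarrow>
      (\<exists>c. proper_coloring G c \<and> (\<forall>v \<in> verts G. c v \<in> L v)))"

definition list_chromatic_number :: "('a, 'b) pre_digraph \<Rightarrow> nat" where
  "list_chromatic_number G = (LEAST n. choosable G n)"

definition vertex_connected :: "('a, 'b) pre_digraph \<Rightarrow> nat \<Rightarrow> bool" where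
  "vertex_connected G n \<longleftrightarrow>
    n < card (verts G) \<and>
    (\<forall>S \<subseteq> verts G. card S < n \<longrightarrow> Digraph_Component.connected (G \<restriction> (verts G - S)))"

text \<open>
  For a finite nonempty graph the supremum is a maximum, so that the complete graph on \<open>n\<close> vertices
  has connectivity \<open>n - 1\<close>; for the graph without vertices the set is empty and its supremum is \<open>0\<close>.
\<close>
definition vertex_connectivity :: "('a, 'b) pre_digraph \<Rightarrow> nat" where
  "vertex_connectivity G = Sup {n. vertex_connected G n}"

end

theory Submission
  imports Defs
begin

text \<open>
  Pass to a vertex set \<open>V\<close> that is minimal with no coloring from some lists of size \<open>4k\<close>; it induces
  minimum degree at least \<open>4k\<close>. Measure the boundary of \<open>W \<subseteq> V\<close> by letting each outside vertex
  contribute its number of neighbours in \<open>W\<close>, capped at \<open>k\<close>, and take \<open>W\<close> minimal subject to having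
  more than \<open>2k\<close> vertices and boundary at most \<open>2k\<^sup>2\<close>. Let \<open>X\<close> consist of the outside vertices that
  reach the cap. If fewer than \<open>k\<close> vertices separated \<open>W \<union> X\<close>, the boundary measure would be almost
  additive over the two sides (vertices below the cap contribute additively, those in \<open>X\<close> see only one
  side), so either one of the sides or \<open>W\<close> minus a side would contradict minimality. Hence \<open>W \<union> X\<close>
  induces a \<open>k\<close>-connected graph.

  Moreover, for some \<open>T \<subset> W\<close> every vertex of \<open>W - T\<close> has at most \<open>3k\<close> neighbours outside \<open>W - T\<close>: put
  into \<open>T\<close> the vertices with more than \<open>k\<close> neighbours below the cap; the boundary bound gives
  \<open>|T| + |X| \<le> 2k\<close>. Coloring everything outside \<open>W - T\<close> leaves at least \<open>k\<close> colors on each vertex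
  of \<open>W - T\<close>, so \<open>W - T\<close> is not \<open>k\<close>-choosable.
\<close>

section \<open>Neighbour counts, list coloring of vertex sets and capped loads\<close>

definition nbrs_in :: "('a \<Rightarrow> 'a \<Rightarrow> bool) \<Rightarrow> 'a \<Rightarrow> 'a set \<Rightarrow> 'a set" where
  "nbrs_in E v A = {u \<in> A. E v u}"

definition colorable_from :: "('a \<Rightarrow> 'a \<Rightarrow> bool) \<Rightarrow> ('a \<Rightarrow> nat set) \<Rightarrow> 'a set \<Rightarrow> bool" where
  "colorable_from E L A \<longleftrightarrow>
    (\<exists>c. (\<forall>u\<in>A. \<forall>v\<in>A. E u v \<longrightarrow> c u \<noteq> c v) \<and> (\<forall>v\<in>A. c v \<in> L v))"

definition choosable_on :: "('a \<Rightarrow> 'a \<Rightarrow> bool) \<Rightarrow> 'a set \<Rightarrow> nat \<Rightarrow> bool" where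
  "choosable_on E A n \<longleftrightarrow>
    (\<forall>L. (\<forall>v\<in>A. finite (L v) \<and> card (L v) = n) \<longrightarrow> colorable_from E L A)"

definition load :: "('a \<Rightarrow> 'a \<Rightarrow> bool) \<Rightarrow> nat \<Rightarrow> 'a set \<Rightarrow> 'a \<Rightarrow> nat" where
  "load E k A y = (if y \<in> A then 0 else min k (card (nbrs_in E y A)))"

definition boundary_load :: "('a \<Rightarrow> 'a \<Rightarrow> bool) \<Rightarrow> 'a set \<Rightarrow> nat \<Rightarrow> 'a set \<Rightarrow> nat" where
  "boundary_load E V k A = (\<Sum>y\<in>V. load E k A y)"

lemma finite_nbrs_in: "finite A \<Longrightarrow> finite (nbrs_in E v A)"
  by (simp add: nbrs_in_def)

lemma card_nbrs_in_le: "finite A \<Longrightarrow> card (nbrs_in E v A) \<le> card A"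
  by (rule card_mono) (auto simp: nbrs_in_def)

lemma card_nbrs_in_mono: "finite B \<Longrightarrow> A \<subseteq> B \<Longrightarrow> card (nbrs_in E v A) \<le> card (nbrs_in E v B)"
  by (rule card_mono) (auto simp: nbrs_in_def)

lemma card_nbrs_in_Un_le:
  "card (nbrs_in E v (A \<union> B)) \<le> card (nbrs_in E v A) + card (nbrs_in E v B)"
proof -
  have "nbrs_in E v (A \<union> B) = nbrs_in E v A \<union> nbrs_in E v B"
    by (auto simp: nbrs_in_def)
  then show ?thesis by (simp add: card_Un_le)
qed

lemma card_nbrs_in_Un_disjoint:
  assumes "finite A" "finite B" "A \<inter> B = {}"
  shows "card (nbrs_in E v (A \<union> B)) = card (nbrs_in E v A) + card (nbrs_in E v B)"
proof -
  have "nbrs_in E v (A \<union> B) = nbrs_in E v A \<union> nbrs_in E v B"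
    by (auto simp: nbrs_in_def)
  moreover have "nbrs_in E v A \<inter> nbrs_in E v B = {}"
    using assms by (auto simp: nbrs_in_def)
  ultimately show ?thesis using assms by (simp add: card_Un_disjoint finite_nbrs_in)
qed

lemma load_le: "load E k A y \<le> k"
  by (simp add: load_def)

lemma card_nbrs_in_sum: "finite A \<Longrightarrow> card (nbrs_in E v A) = (\<Sum>u\<in>A. if E v u then 1 else 0)"
  unfolding nbrs_in_def card_eq_sum by (rule sum.inter_filter)

lemma colorable_from_mono_lists:
  assumes "colorable_from E L' A" "\<And>v. v \<in> A \<Longrightarrow> L' v \<subseteq> L v"
  shows "colorable_from E L A"
  using assms unfolding colorable_from_def by blast

lemma choosable_on_mono:
  assumes "choosable_on E A m" "m \<le> n"
  shows "choosable_on E A n"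
  unfolding choosable_on_def
proof (intro allI impI)
  fix L :: "'a \<Rightarrow> nat set" assume L: "\<forall>v\<in>A. finite (L v) \<and> card (L v) = n"
  have "\<exists>B. B \<subseteq> L v \<and> finite B \<and> card B = m" if "v \<in> A" for v
    using L assms(2) that obtain_subset_with_card_n[of m "L v"] by metis
  then obtain L' where L': "\<forall>v\<in>A. L' v \<subseteq> L v \<and> finite (L' v) \<and> card (L' v) = m" by metis
  then have "colorable_from E L' A" using assms(1) unfolding choosable_on_def by blast
  then show "colorable_from E L A"
    using L' by (auto intro: colorable_from_mono_lists)
qed

lemma choosable_on_subset:
  assumes "choosable_on E A n" "B \<subseteq> A"
  shows "choosable_on E B n"
  unfolding choosable_on_def
proof (intro allI impI)
  fix L :: "'a \<Rightarrow> nat set" assume L: "\<forall>v\<in>B. finite (L v) \<and> card (L v) = n"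
  \<comment> \<open>Vertices outside \<open>B\<close> get dummy lists of the right size, so that the
    hypothesis on \<open>A\<close> applies.\<close>
  define L' where "L' v = (if v \<in> B then L v else {..<n})" for v
  have "\<forall>v\<in>A. finite (L' v) \<and> card (L' v) = n" using L by (auto simp: L'_def)
  then obtain c where "\<forall>u\<in>A. \<forall>v\<in>A. E u v \<longrightarrow> c u \<noteq> c v" "\<forall>v\<in>A. c v \<in> L' v"
    using assms(1) unfolding choosable_on_def colorable_from_def by blast
  then show "colorable_from E L B"
    unfolding colorable_from_def using assms(2) by (intro exI[of _ c] conjI ballI) (force simp: L'_def subset_iff)+
qed

section \<open>Critical vertex sets, and the size gap for sets of small boundary\<close>

locale adjacency =
  fixes E :: "'a \<Rightarrow> 'a \<Rightarrow> bool"
  assumes sym: "E u v \<Longrightarrow> E v u"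
    and irrefl: "\<not> E v v"
begin

lemma sum_card_nbrs_in_swap:
  assumes "finite A" "finite B"
  shows "(\<Sum>a\<in>A. card (nbrs_in E a B)) = (\<Sum>b\<in>B. card (nbrs_in E b A))"
proof -
  have "(\<Sum>a\<in>A. card (nbrs_in E a B)) = (\<Sum>a\<in>A. \<Sum>b\<in>B. if E a b then 1 else 0)"
    using assms by (simp add: card_nbrs_in_sum)
  also have "\<dots> = (\<Sum>b\<in>B. \<Sum>a\<in>A. if E b a then 1 else 0)"
    by (subst sum.swap) (auto intro!: sum.cong dest: sym)
  finally show ?thesis using assms by (simp add: card_nbrs_in_sum)
qed

text \<open>A coloring of \<open>V - U\<close> costs a vertex of \<open>U\<close> at most one color
  per neighbour outside \<open>U\<close>, so \<open>m\<close> colors survive; a coloring of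
  \<open>U\<close> from surviving colors would extend it to all of \<open>V\<close>. Used for a
  single vertex with \<open>m = 1\<close> and for the final core with \<open>m = k\<close>.\<close>

lemma residual_not_choosable:
  assumes "finite V" "U \<subseteq> V" "\<not> colorable_from E L V" "colorable_from E L (V - U)"
    and big: "\<And>u. u \<in> U \<Longrightarrow> card (nbrs_in E u (V - U)) + m \<le> card (L u)"
  shows "\<not> choosable_on E U m"
proof
  assume ch: "choosable_on E U m"
  obtain c where c: "\<forall>u\<in>V-U. \<forall>v\<in>V-U. E u v \<longrightarrow> c u \<noteq> c v" "\<forall>v\<in>V-U. c v \<in> L v"
    using assms(4) unfolding colorable_from_def by blast
  define R where "R u = L u - c ` nbrs_in E u (V - U)" for u
  have "\<exists>B. B \<subseteq> R u \<and> finite B \<and> card B = m" if "u \<in> U" for u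
  proof -
    have fn: "finite (nbrs_in E u (V - U))" using assms(1) by (simp add: finite_nbrs_in)
    have "card (L u) - card (c ` nbrs_in E u (V - U)) \<le> card (R u)"
      unfolding R_def by (rule diff_card_le_card_Diff) (simp add: fn)
    moreover have "card (c ` nbrs_in E u (V - U)) \<le> card (nbrs_in E u (V - U))"
      by (rule card_image_le[OF fn])
    ultimately have "m \<le> card (R u)" using big[OF that] by linarith
    then show ?thesis using obtain_subset_with_card_n[of m "R u"] by metis
  qed
  then obtain L' where L': "\<forall>u\<in>U. L' u \<subseteq> R u \<and> finite (L' u) \<and> card (L' u) = m" by metis
  then obtain d where d: "\<forall>u\<in>U. \<forall>v\<in>U. E u v \<longrightarrow> d u \<noteq> d v" "\<forall>v\<in>U. d v \<in> L' v"
    using ch unfolding choosable_on_def colorable_from_def by blast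
  define e where "e v = (if v \<in> U then d v else c v)" for v
  have dR: "d v \<in> R v" if "v \<in> U" for v using d(2) L' that by blast
  have cross: "d u \<noteq> c v" if "u \<in> U" "v \<in> V - U" "E u v" for u v
    using dR[OF that(1)] that by (auto simp: R_def nbrs_in_def)
  have "e u \<noteq> e v" if "u \<in> V" "v \<in> V" "E u v" for u v
    using that c(1) d(1) cross[of u v] cross[of v u, symmetric] sym[OF that(3)]
    unfolding e_def by (cases "u \<in> U"; cases "v \<in> U") simp_all
  moreover have "e v \<in> L v" if "v \<in> V" for v
    using that c(2) dR[of v] by (auto simp: e_def R_def)
  ultimately have "colorable_from E L V" unfolding colorable_from_def by blast
  then show False using assms(3) by contradiction
qed

lemma critical_min_degree:
  assumes "finite V" "\<not> colorable_from E L V" "\<And>U. U \<subset> V \<Longrightarrow> colorable_from E L U"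
    and L: "\<And>v. v \<in> V \<Longrightarrow> finite (L v) \<and> card (L v) = n"
    and v: "v \<in> V"
  shows "n \<le> card (nbrs_in E v V)"
proof (rule ccontr)
  assume "\<not> ?thesis"
  moreover have "card (nbrs_in E v (V - {v})) \<le> card (nbrs_in E v V)"
    using assms(1) by (intro card_nbrs_in_mono) auto
  \<comment> \<open>A vertex with fewer than \<open>n\<close> neighbours always keeps a color, and
    one color suffices for one vertex.\<close>
  ultimately have "\<not> choosable_on E {v} 1"
    using assms by (intro residual_not_choosable[of V _ L]) auto
  moreover have "choosable_on E {v} 1"
    unfolding choosable_on_def colorable_from_def
  proof (intro allI impI)
    fix M :: "'a \<Rightarrow> nat set" assume "\<forall>u\<in>{v}. finite (M u) \<and> card (M u) = 1"
    then obtain x where "M v = {x}" by (auto simp: card_1_singleton_iff)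
    then show "\<exists>c. (\<forall>u\<in>{v}. \<forall>w\<in>{v}. E u w \<longrightarrow> c u \<noteq> c w) \<and> (\<forall>u\<in>{v}. c u \<in> M u)"
      using irrefl by (intro exI[of _ "\<lambda>_. x"]) auto
  qed
  ultimately show False by contradiction
qed

lemma critical_subset_exists:
  assumes "finite V" "\<not> colorable_from E L V"
  obtains U where "U \<subseteq> V" "\<not> colorable_from E L U" "\<And>U'. U' \<subset> U \<Longrightarrow> colorable_from E L U'"
proof -
  have "finite {U. U \<subseteq> V \<and> \<not> colorable_from E L U}"
    using assms(1) by simp
  moreover have "{U. U \<subseteq> V \<and> \<not> colorable_from E L U} \<noteq> {}" using assms(2) by blast
  ultimately obtain U where "U \<in> {U. U \<subseteq> V \<and> \<not> colorable_from E L U}"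
    "\<forall>B\<in>{U. U \<subseteq> V \<and> \<not> colorable_from E L U}. B \<subseteq> U \<longrightarrow> B = U"
    using finite_has_minimal[of "{U. U \<subseteq> V \<and> \<not> colorable_from E L U}"] by metis
  then show thesis by (intro that[of U]) auto
qed

text \<open>Ensures that the minimum defining the list chromatic number is attained. A critical
  subset would contain a vertex with \<open>card V\<close> neighbours in it, too many since no
  vertex neighbours itself.\<close>

lemma choosable_on_card:
  assumes "finite V"
  shows "choosable_on E V (card V)"
  unfolding choosable_on_def
proof (intro allI impI, rule ccontr)
  fix L :: "'a \<Rightarrow> nat set" assume L: "\<forall>v\<in>V. finite (L v) \<and> card (L v) = card V" and "\<not> colorable_from E L V"
  then obtain U where U: "U \<subseteq> V" "\<not> colorable_from E L U"
    "\<And>U'. U' \<subset> U \<Longrightarrow> colorable_from E L U'"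
    using critical_subset_exists[OF assms] by metis
  have fU: "finite U" using U(1) assms by (rule finite_subset)
  have "U \<noteq> {}" using U(2) by (auto simp: colorable_from_def)
  then obtain v where v: "v \<in> U" by blast
  have "card V \<le> card (nbrs_in E v U)"
    using critical_min_degree[OF fU U(2,3) _ v] L U(1) by blast
  also have "\<dots> \<le> card (U - {v})"
    using fU irrefl by (intro card_mono) (auto simp: nbrs_in_def)
  also have "\<dots> < card U" using fU v by (rule card_Diff1_less)
  also have "\<dots> \<le> card V" using assms U(1) by (rule card_mono)
  finally show False by simp
qed

text \<open>
  By this gap a set of small boundary has either more than \<open>2k\<close> or fewer than \<open>k\<close> vertices, so
  removing one of the latter kind from one of the former kind cannot destroy the size condition.
\<close>
lemma boundary_load_gap:
  assumes "finite V" "U \<subseteq> V" and deg: "\<And>v. v \<in> V \<Longrightarrow> 4 * k \<le> card (nbrs_in E v V)"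
    and "0 < k" "k \<le> card U" "card U \<le> 2 * k"
  shows "2 * k * k < boundary_load E V k U"
proof -
  let ?n = "card U"
  have fU: "finite U" using assms(1,2) by (rule finite_subset[rotated])
  \<comment> \<open>Of at least \<open>4 * k\<close> neighbours, at most \<open>2 * k - 1\<close>
    lie in \<open>U\<close>.\<close>
  have out: "2 * k + 1 \<le> card (nbrs_in E u (V - U))" if u: "u \<in> U" for u
  proof -
    have "card (nbrs_in E u V) \<le> card (nbrs_in E u (V - U)) + card (nbrs_in E u U)"
      using card_nbrs_in_Un_le[of E u "V - U" U] assms(2) by (simp add: Un_absorb2)
    moreover have "card (nbrs_in E u U) \<le> card (U - {u})"
      using fU irrefl by (intro card_mono) (auto simp: nbrs_in_def)
    moreover have "card (U - {u}) < ?n" using fU u by (rule card_Diff1_less)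
    moreover have "4 * k \<le> card (nbrs_in E u V)" using deg u assms(2) by blast
    ultimately show ?thesis using assms(6) by linarith
  qed
  \<comment> \<open>Both \<open>k\<close> and the number of neighbours are at most
    \<open>?n\<close>, which covers the vertices below the cap and those above it.\<close>
  have pt: "k * card (nbrs_in E y U) \<le> ?n * load E k U y" if y: "y \<in> V - U" for y
  proof -
    have d: "card (nbrs_in E y U) \<le> ?n" using fU by (rule card_nbrs_in_le)
    show ?thesis
    proof (cases "card (nbrs_in E y U) \<le> k")
      case True
      then show ?thesis using y assms(5) by (simp add: load_def min_def)
    next
      case False
      then show ?thesis using y d by (simp add: load_def min_def mult.commute)
    qed
  qed
  \<comment> \<open>Count the edges leaving \<open>U\<close> from both ends, with weight
    \<open>k\<close>; the factor \<open>?n\<close> cancels at the end.\<close>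
  have "?n * (k * (2 * k + 1)) = k * (\<Sum>u\<in>U. 2 * k + 1)" by (simp add: algebra_simps)
  also have "\<dots> \<le> k * (\<Sum>u\<in>U. card (nbrs_in E u (V - U)))"
    using out by (intro mult_left_mono sum_mono) auto
  also have "\<dots> = k * (\<Sum>y\<in>V - U. card (nbrs_in E y U))"
    using assms(1) fU by (simp add: sum_card_nbrs_in_swap)
  also have "\<dots> \<le> (\<Sum>y\<in>V - U. ?n * load E k U y)"
    unfolding sum_distrib_left by (intro sum_mono pt)
  also have "\<dots> \<le> (\<Sum>y\<in>V. ?n * load E k U y)"
    using assms(1) by (intro sum_mono2) auto
  also have "\<dots> = ?n * boundary_load E V k U"
    by (simp add: boundary_load_def sum_distrib_left)
  finally have "k * (2 * k + 1) \<le> boundary_load E V k U"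
    using assms(4,5) by simp
  then show ?thesis using assms(4) by (simp add: algebra_simps)
qed

end

section \<open>Boundary loads when fewer than \<open>k\<close> vertices separate
  \<open>W \<union> X\<close>\<close>

locale separated_core = adjacency E for E :: "'a \<Rightarrow> 'a \<Rightarrow> bool" +
  fixes V W X S C D :: "'a set" and k :: nat
  assumes finV: "finite V" and WV: "W \<subseteq> V" and kpos: "0 < k"
    and X_def: "X = {y \<in> V - W. k \<le> card (nbrs_in E y W)}"
    and cover: "S \<union> C \<union> D = W \<union> X"
    and disj: "S \<inter> C = {}" "S \<inter> D = {}" "C \<inter> D = {}"
    and small_cut: "card S < k"
    and no_edge: "\<And>u v. u \<in> C \<Longrightarrow> v \<in> D \<Longrightarrow> \<not> E u v"
begin

text \<open>The two sides play symmetric roles, so each one-sided estimate is also available with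
  \<open>C\<close> and \<open>D\<close> exchanged.\<close>

lemma flip: "separated_core E V W X S D C k"
proof
  show "\<not> E u v" if "u \<in> D" "v \<in> C" for u v using no_edge[OF that(2,1)] sym by blast
qed (use finV WV kpos X_def cover disj small_cut in auto)

lemma finW: "finite W" using WV finV by (rule finite_subset)

lemma subV: "S \<subseteq> V" "C \<subseteq> V" "D \<subseteq> V"
  using cover WV by (auto simp: X_def)

lemma finS: "finite S" using subV(1) finV by (rule finite_subset)

lemma load_zero: "y \<in> C \<Longrightarrow> load E k (D \<inter> W) y = 0"
proof -
  assume "y \<in> C"
  then have "nbrs_in E y (D \<inter> W) = {}" using no_edge by (auto simp: nbrs_in_def)
  then show ?thesis by (simp add: load_def)
qed

lemma load_mono_side: "y \<in> D \<or> y \<notin> W \<Longrightarrow> load E k (D \<inter> W) y \<le> load E k W y"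
  using card_nbrs_in_mono[of W "D \<inter> W" E y] finW by (auto simp: load_def)

text \<open>Outside \<open>X\<close> the cap is not reached, so the load of \<open>W\<close> is an
  exact neighbour count and is additive over disjoint parts.\<close>

lemma low_split:
  assumes "y \<in> V" "y \<notin> W" "y \<notin> X"
  shows "load E k (C \<inter> W) y + load E k (D \<inter> W) y \<le> load E k W y"
proof -
  have "card (nbrs_in E y (C \<inter> W)) + card (nbrs_in E y (D \<inter> W))
      = card (nbrs_in E y ((C \<inter> W) \<union> (D \<inter> W)))"
    using finW disj by (intro card_nbrs_in_Un_disjoint[symmetric]) auto
  also have "\<dots> \<le> card (nbrs_in E y W)" using finW by (intro card_nbrs_in_mono) auto
  finally show ?thesis using assms by (auto simp: load_def X_def)
qed

text \<open>A vertex of \<open>C\<close> or \<open>D\<close> sees only its own side, and vertices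
  below the cap split additively. Only separator vertices can cost extra, at most \<open>k\<close>
  for each side.\<close>

lemma boundary_load_sides:
  "boundary_load E V k (C \<inter> W) + boundary_load E V k (D \<inter> W)
    \<le> boundary_load E V k W + 2 * k * card S"
proof -
  interpret f: separated_core E V W X S D C k by (rule flip)
  have "load E k (C \<inter> W) y + load E k (D \<inter> W) y \<le> load E k W y + (if y \<in> S then 2 * k else 0)"
    if y: "y \<in> V" for y
  proof -
    consider "y \<in> S" | "y \<in> C" "y \<notin> S" | "y \<in> D" "y \<notin> S" | "y \<notin> W" "y \<notin> X" using cover by blast
    then show ?thesis
    proof cases
      case 1
      then show ?thesis using load_le[of E k "C \<inter> W" y] load_le[of E k "D \<inter> W" y] by simp
    next
      case 2
      then show ?thesis using load_zero f.load_mono_side[of y] by simp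
    next
      case 3
      then show ?thesis using f.load_zero load_mono_side[of y] by simp
    next
      case 4
      then show ?thesis using low_split[OF y] by simp
    qed
  qed
  then have "(\<Sum>y\<in>V. load E k (C \<inter> W) y + load E k (D \<inter> W) y)
      \<le> (\<Sum>y\<in>V. load E k W y + (if y \<in> S then 2 * k else 0))"
    by (intro sum_mono)
  also have "\<dots> = boundary_load E V k W + 2 * k * card S"
    using finV subV(1) by (simp add: sum.distrib boundary_load_def sum.If_cases Int_absorb1)
  finally show ?thesis by (simp add: sum.distrib boundary_load_def)
qed

text \<open>Passing from \<open>W\<close> to \<open>D \<inter> W\<close> saves the full load
  \<open>k\<close> at each vertex of \<open>C \<inter> X\<close>, which sees nothing of
  \<open>D\<close>; each separator vertex costs at most \<open>k\<close>.\<close>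

lemma boundary_load_other_side:
  "boundary_load E V k (D \<inter> W) + k * card (C \<inter> X) \<le> boundary_load E V k W + k * card S"
proof -
  have "load E k (D \<inter> W) y + (if y \<in> C \<inter> X then k else 0) \<le> load E k W y + (if y \<in> S then k else 0)"
    if y: "y \<in> V" for y
  proof -
    consider "y \<in> S" | "y \<in> C" "y \<notin> S" | "y \<in> D" "y \<notin> S" | "y \<notin> W" "y \<notin> X" using cover by blast
    then show ?thesis
    proof cases
      case 1
      then show ?thesis using load_le[of E k "D \<inter> W" y] disj by auto
    next
      case 2
      then show ?thesis using load_zero by (auto simp: load_def X_def)
    next
      case 3
      then show ?thesis using load_mono_side[of y] disj by auto
    next
      case 4
      then show ?thesis using low_split[OF y] by simp
    qed
  qed
  then have "(\<Sum>y\<in>V. load E k (D \<inter> W) y + (if y \<in> C \<inter> X then k else 0))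
      \<le> (\<Sum>y\<in>V. load E k W y + (if y \<in> S then k else 0))"
    by (intro sum_mono)
  moreover have "V \<inter> {y \<in> C. y \<in> X} = C \<inter> X" "V \<inter> S = S" using subV by auto
  ultimately show ?thesis
    using finV by (simp add: sum.distrib boundary_load_def sum.If_cases mult.commute)
qed

text \<open>A removed vertex sees only separator vertices in \<open>W - C\<close>, so it adds at
  most \<open>card S\<close> to the boundary. In return each of its edges to vertices below the cap
  stops counting, and the degree bound leaves at least \<open>card S\<close> such edges.\<close>

lemma boundary_load_remove_side:
  assumes deg: "\<And>v. v \<in> V \<Longrightarrow> 4 * k \<le> card (nbrs_in E v V)"
    and "card (C \<inter> W) < k" "card (C \<inter> X) \<le> k"
  shows "boundary_load E V k (W - C) \<le> boundary_load E V k W"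
proof -
  let ?Y = "V - W - X" and ?A = "C \<inter> W"
  have fA: "finite ?A" and fY: "finite ?Y" and fX: "finite (C \<inter> X)"
    using finW finV by (auto simp: X_def)
  have low: "card S \<le> card (nbrs_in E w ?Y)" if w: "w \<in> ?A" for w
  proof -
    have "nbrs_in E w V \<subseteq> ?A \<union> S \<union> (C \<inter> X) \<union> nbrs_in E w ?Y"
      using w no_edge cover by (auto simp: nbrs_in_def)
    then have "card (nbrs_in E w V) \<le> card (?A \<union> S \<union> (C \<inter> X) \<union> nbrs_in E w ?Y)"
      using fA finS fX fY by (intro card_mono) (auto simp: finite_nbrs_in)
    also have "\<dots> \<le> card ?A + card S + card (C \<inter> X) + card (nbrs_in E w ?Y)"
      by (metis (no_types, lifting) card_Un_le add_le_mono1 order_trans)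
    finally show ?thesis using deg[of w] w WV assms(2,3) small_cut by force
  qed
  have pt: "load E k (W - C) y + (if y \<in> ?Y then card (nbrs_in E y ?A) else 0)
      \<le> load E k W y + (if y \<in> ?A then card S else 0)" if y: "y \<in> V" for y
  proof -
    consider "y \<in> ?A" | "y \<in> W - C" | "y \<in> X" | "y \<in> ?Y" using y by blast
    then show ?thesis
    proof cases
      case 1
      have "card (nbrs_in E y (W - C)) \<le> card S"
        using 1 no_edge cover finS by (intro card_mono) (auto simp: nbrs_in_def)
      then show ?thesis using 1 by (simp add: load_def)
    next
      case 2
      then show ?thesis by (simp add: load_def)
    next
      case 3
      have "card (nbrs_in E y (W - C)) \<le> card (nbrs_in E y W)"
        using finW by (intro card_nbrs_in_mono) auto
      then show ?thesis using 3 by (auto simp: load_def X_def)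
    next
      case 4
      have "card (nbrs_in E y (W - C)) + card (nbrs_in E y ?A) = card (nbrs_in E y ((W - C) \<union> ?A))"
        using finW by (intro card_nbrs_in_Un_disjoint[symmetric]) auto
      also have "(W - C) \<union> ?A = W" by auto
      finally show ?thesis using 4 by (auto simp: load_def X_def)
    qed
  qed
  have "(\<Sum>y\<in>V. load E k (W - C) y + (if y \<in> ?Y then card (nbrs_in E y ?A) else 0))
      \<le> (\<Sum>y\<in>V. load E k W y + (if y \<in> ?A then card S else 0))"
    by (intro sum_mono pt)
  moreover have "(\<Sum>y\<in>V. if y \<in> ?Y then card (nbrs_in E y ?A) else 0) = (\<Sum>y\<in>?Y. card (nbrs_in E y ?A))"
    using finV by (intro sum.mono_neutral_cong_right) auto
  moreover have "(\<Sum>y\<in>V. if y \<in> ?A then card S else 0) = (\<Sum>y\<in>?A. card S)"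
    using finV subV by (intro sum.mono_neutral_cong_right) auto
  moreover have "(\<Sum>y\<in>?A. card S) \<le> (\<Sum>y\<in>?Y. card (nbrs_in E y ?A))"
    unfolding sum_card_nbrs_in_swap[OF fY fA] by (intro sum_mono low)
  ultimately show ?thesis by (simp add: sum.distrib boundary_load_def)
qed

text \<open>
  The side of smaller load must have fewer than \<open>k\<close> vertices in \<open>W\<close>. It can be removed from \<open>W\<close>
  unless it contains more than \<open>k\<close> vertices of \<open>X\<close>; but then the other side has small load, hence is
  small as well, and the same reasoning puts more than \<open>2k\<close> vertices into \<open>X\<close>.
\<close>
lemma separator_contradiction:
  assumes deg: "\<And>v. v \<in> V \<Longrightarrow> 4 * k \<le> card (nbrs_in E v V)"
    and large: "2 * k < card W" and load: "boundary_load E V k W \<le> 2 * k * k"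
    and min: "\<And>W'. W' \<subset> W \<Longrightarrow> 2 * k < card W' \<Longrightarrow> 2 * k * k < boundary_load E V k W'"
    and C: "C \<inter> W \<noteq> {}" and D: "D \<inter> W \<noteq> {}"
    and side: "boundary_load E V k (C \<inter> W) \<le> boundary_load E V k (D \<inter> W)"
  shows False
proof -
  interpret f: separated_core E V W X S D C k by (rule flip)
  \<comment> \<open>Minimality of \<open>W\<close> excludes more than \<open>2 * k\<close> vertices,
    \<open>boundary_load_gap\<close> excludes sizes from \<open>k\<close> to
    \<open>2 * k\<close>.\<close>
  have gap: "card U < k" if "U \<subset> W" "boundary_load E V k U \<le> 2 * k * k" for U
    using boundary_load_gap[OF finV _ deg kpos, of U] min[OF that(1)] that WV
    by (meson linorder_not_less order_trans psubset_imp_subset)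
  have remove: False if "W' \<subseteq> W" "card W' < k" "W' \<noteq> {}" "boundary_load E V k (W - W') \<le> 2 * k * k" for W'
  proof -
    have "W - W' \<subset> W" using that(1,3) by blast
    then have "card (W - W') < k" using gap that(4) by blast
    moreover have "card W = card (W - W') + card W'"
      using that(1) finW by (metis card_Diff_subset card_mono finite_subset le_add_diff_inverse2)
    ultimately show False using that(2) large by linarith
  qed
  have CW: "C \<inter> W \<subset> W" and DW: "D \<inter> W \<subset> W" using C D disj by auto
  \<comment> \<open>The loads of the two sides add up to at most \<open>4 * k * k\<close>, so the
    smaller one is at most half of that.\<close>
  have "k * card S \<le> k * k" using small_cut by simp
  then have "boundary_load E V k (C \<inter> W) \<le> 2 * k * k"
    using boundary_load_sides load side by linarith
  then have smallC: "card (C \<inter> W) < k" using gap CW by blast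
  have pC: "k < card (C \<inter> X)"
  proof (rule ccontr)
    assume "\<not> ?thesis"
    then have "boundary_load E V k (W - C) \<le> 2 * k * k"
      using boundary_load_remove_side[OF deg smallC] load by simp
    moreover have "W - C = W - C \<inter> W" by auto
    ultimately show False using remove[of "C \<inter> W"] C smallC by simp
  qed
  have "k * card S \<le> k * card (C \<inter> X)" using pC small_cut by simp
  then have "boundary_load E V k (D \<inter> W) \<le> 2 * k * k"
    using boundary_load_other_side load by linarith
  then have smallD: "card (D \<inter> W) < k" using gap DW by blast
  have pD: "k < card (D \<inter> X)"
  proof (rule ccontr)
    assume "\<not> ?thesis"
    then have "boundary_load E V k (W - D) \<le> 2 * k * k"
      using f.boundary_load_remove_side[OF deg smallD] load by simp
    moreover have "W - D = W - D \<inter> W" by auto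
    ultimately show False using remove[of "D \<inter> W"] D smallD by simp
  qed
  have "2 * k < card (C \<inter> X) + card (D \<inter> X)" using pC pD by simp
  also have "\<dots> = card ((C \<inter> X) \<union> (D \<inter> X))"
    using disj finV by (intro card_Un_disjoint[symmetric]) (auto simp: X_def)
  also have "\<dots> \<le> card X" using finV by (intro card_mono) (auto simp: X_def)
  \<comment> \<open>Every vertex of \<open>X\<close> has load exactly \<open>k\<close>, so more than
    \<open>2 * k\<close> of them exceed the bound on the load of \<open>W\<close>.\<close>
  finally have "k * (2 * k) < k * card X" using kpos by simp
  also have "\<dots> = (\<Sum>y\<in>X. load E k W y)" by (simp add: load_def X_def)
  also have "\<dots> \<le> boundary_load E V k W"
    unfolding boundary_load_def using finV by (intro sum_mono2) (auto simp: X_def)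
  finally show False using load by simp
qed

text \<open>A vertex of a side that avoids \<open>W\<close> lies in \<open>X\<close> and has
  \<open>k\<close> neighbours in \<open>W\<close>; these could only lie in \<open>S\<close>, which
  is too small.\<close>

lemma side_meets_core: "C \<inter> W = {} \<Longrightarrow> C = {}"
proof (rule ccontr)
  assume CW: "C \<inter> W = {}" and "C \<noteq> {}"
  then obtain y where y: "y \<in> C" by blast
  then have "y \<in> X" using CW cover by blast
  then have "k \<le> card (nbrs_in E y W)" by (simp add: X_def)
  also have "\<dots> \<le> card S"
    using y CW no_edge cover finS by (intro card_mono) (auto simp: nbrs_in_def)
  finally show False using small_cut by simp
qed

lemma one_side_empty:
  assumes deg: "\<And>v. v \<in> V \<Longrightarrow> 4 * k \<le> card (nbrs_in E v V)"
    and large: "2 * k < card W" and load: "boundary_load E V k W \<le> 2 * k * k"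
    and min: "\<And>W'. W' \<subset> W \<Longrightarrow> 2 * k < card W' \<Longrightarrow> 2 * k * k < boundary_load E V k W'"
  shows "C = {} \<or> D = {}"
proof (rule ccontr)
  interpret f: separated_core E V W X S D C k by (rule flip)
  assume "\<not> ?thesis"
  then have "C \<inter> W \<noteq> {}" "D \<inter> W \<noteq> {}" using side_meets_core f.side_meets_core by auto
  then show False
    using separator_contradiction[OF deg large load min] f.separator_contradiction[OF deg large load min]
    by (meson linorder_le_cases)
qed

end

section \<open>The minimal set \<open>W\<close> and the core it yields\<close>

context adjacency
begin

text \<open>\<open>Q\<close> is \<open>W \<union> X\<close> and \<open>U\<close> is
  \<open>W - T\<close>. Connectivity is phrased through partitions without crossing edges, the form
  in which the load estimates apply.\<close>

lemma highly_connected_core_exists: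
  assumes finV: "finite V" and ne: "V \<noteq> {}" and kpos: "0 < k"
    and deg: "\<And>v. v \<in> V \<Longrightarrow> 4 * k \<le> card (nbrs_in E v V)"
  obtains Q U where "U \<subseteq> Q" "Q \<subseteq> V" "U \<noteq> {}" "k < card Q"
    "\<And>u. u \<in> U \<Longrightarrow> card (nbrs_in E u (V - U)) \<le> 3 * k"
    "\<And>S C D. S \<subseteq> Q \<Longrightarrow> card S < k \<Longrightarrow> C \<union> D = Q - S \<Longrightarrow> C \<inter> D = {} \<Longrightarrow>
      (\<And>u v. u \<in> C \<Longrightarrow> v \<in> D \<Longrightarrow> \<not> E u v) \<Longrightarrow> C = {} \<or> D = {}"
proof -
  let ?F = "{W. W \<subseteq> V \<and> 2 * k < card W \<and> boundary_load E V k W \<le> 2 * k * k}"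
  obtain v where "v \<in> V" using ne by blast
  then have "4 * k \<le> card V" using deg card_nbrs_in_le[OF finV] order_trans by blast
  \<comment> \<open>The whole set has no boundary, and the degree bound makes it large
    enough.\<close>
  then have "V \<in> ?F" using kpos by (simp add: boundary_load_def load_def)
  then have "?F \<noteq> {}" by blast
  moreover have "finite ?F" using finV by simp
  ultimately obtain W where WF: "W \<in> ?F" and Wmin: "\<forall>B\<in>?F. B \<subseteq> W \<longrightarrow> W = B"
    using finite_has_minimal[of ?F] by blast
  have WV: "W \<subseteq> V" and large: "2 * k < card W" and bl: "boundary_load E V k W \<le> 2 * k * k"
    using WF by auto
  have min: "2 * k * k < boundary_load E V k W'" if "W' \<subset> W" "2 * k < card W'" for W'
  proof (rule ccontr)
    assume "\<not> ?thesis"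
    then have "W' \<in> ?F" using that WV by auto
    then show False using Wmin that(1) by blast
  qed
  have finW: "finite W" using WV finV by (rule finite_subset)
  define X where "X = {y \<in> V - W. k \<le> card (nbrs_in E y W)}"
  define Y where "Y = V - W - X"
  define T where "T = {w \<in> W. k < card (nbrs_in E w Y)}"
  have finX: "finite X" and finY: "finite Y" and finT: "finite T"
    using finV finW by (auto simp: X_def Y_def T_def)
  \<comment> \<open>Vertices of \<open>T\<close> send at least \<open>k\<close> edges each into
    \<open>Y\<close>, where loads are exact; vertices of \<open>X\<close> carry load
    \<open>k\<close> each. Together they are paid for by the boundary load of
    \<open>W\<close>.\<close>
  have "k * card T = (\<Sum>w\<in>T. k)" by simp
  also have "\<dots> \<le> (\<Sum>w\<in>T. card (nbrs_in E w Y))"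
    by (intro sum_mono) (simp add: T_def)
  also have "\<dots> \<le> (\<Sum>w\<in>W. card (nbrs_in E w Y))"
    using finW by (intro sum_mono2) (auto simp: T_def)
  also have "\<dots> = (\<Sum>y\<in>Y. card (nbrs_in E y W))"
    using finW finY by (rule sum_card_nbrs_in_swap)
  also have "\<dots> = (\<Sum>y\<in>Y. load E k W y)"
    by (intro sum.cong) (auto simp: Y_def X_def load_def)
  finally have "k * card T + k * card X \<le> (\<Sum>y\<in>Y. load E k W y) + (\<Sum>y\<in>X. load E k W y)"
    by (simp add: X_def load_def)
  also have "\<dots> = (\<Sum>y\<in>Y \<union> X. load E k W y)"
    using finX finY by (intro sum.union_disjoint[symmetric]) (auto simp: Y_def)
  also have "\<dots> \<le> boundary_load E V k W"
    unfolding boundary_load_def using finV by (intro sum_mono2) (auto simp: Y_def X_def)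
  also have "\<dots> \<le> k * (2 * k)" using bl by simp
  finally have "k * (card T + card X) \<le> k * (2 * k)" by (simp add: distrib_left)
  then have TX: "card T + card X \<le> 2 * k" using kpos by simp
  show thesis
  proof (rule that[of "W - T" "W \<union> X"])
    show "W - T \<noteq> {}"
    proof
      assume "W - T = {}"
      then have "card W \<le> card T" using finT by (intro card_mono) auto
      then show False using large TX by linarith
    qed
    have "card W \<le> card (W \<union> X)" using finW finX by (intro card_mono) auto
    then show "k < card (W \<union> X)" using large by linarith
    show "card (nbrs_in E u (V - (W - T))) \<le> 3 * k" if u: "u \<in> W - T" for u
    proof -
      have "nbrs_in E u (V - (W - T)) \<subseteq> T \<union> X \<union> nbrs_in E u Y"
        by (auto simp: nbrs_in_def Y_def)
      then have "card (nbrs_in E u (V - (W - T))) \<le> card (T \<union> X \<union> nbrs_in E u Y)"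
        using finT finX finY by (intro card_mono) (auto simp: finite_nbrs_in)
      also have "\<dots> \<le> card T + card X + card (nbrs_in E u Y)"
        using card_Un_le[of "T \<union> X" "nbrs_in E u Y"] card_Un_le[of T X] by linarith
      also have "card (nbrs_in E u Y) \<le> k" using u by (auto simp: T_def)
      finally show ?thesis using TX by linarith
    qed
    show "C = {} \<or> D = {}"
      if "S \<subseteq> W \<union> X" "card S < k" "C \<union> D = W \<union> X - S" "C \<inter> D = {}"
        "\<And>u v. u \<in> C \<Longrightarrow> v \<in> D \<Longrightarrow> \<not> E u v" for S C D
    proof -
      interpret separated_core E V W X S C D k
        using that finV WV kpos by unfold_locales (auto simp: X_def)
      show ?thesis by (rule one_side_empty[OF deg large bl min])
    qed
  qed (use WV in \<open>auto simp: X_def\<close>)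
qed

end

section \<open>Translation to induced subgraphs, and the theorem\<close>

lemma dominates_induce_subgraph_iff:
  "u \<rightarrow>\<^bsub>G \<restriction> A\<^esub> v \<longleftrightarrow> u \<in> A \<and> v \<in> A \<and> u \<rightarrow>\<^bsub>G\<^esub> v"
  by (auto simp: arcs_ends_def arc_to_ends_def image_iff)

lemma choosable_induce_subgraph_iff:
  "choosable (G \<restriction> A) n \<longleftrightarrow> choosable_on (\<lambda>u v. u \<rightarrow>\<^bsub>G\<^esub> v) A n"
  unfolding choosable_def choosable_on_def colorable_from_def proper_coloring_def
    dominates_induce_subgraph_iff induce_subgraph_verts
  by (intro all_cong1 imp_cong ex_cong1 conj_cong refl) blast

context graph
begin

lemma adjacency_dominates: "adjacency (\<lambda>u v. u \<rightarrow>\<^bsub>G\<^esub> v)"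
proof
  show "v \<rightarrow>\<^bsub>G\<^esub> u" if "u \<rightarrow>\<^bsub>G\<^esub> v" for u v using that by (rule arcs_ends_symmetric[OF sym_arcs])
  show "\<not> v \<rightarrow>\<^bsub>G\<^esub> v" for v using adj_not_same by blast
qed

lemma graph_induce_subgraph:
  assumes "A \<subseteq> verts G"
  shows "graph (G \<restriction> A)"
proof -
  have "induced_subgraph (G \<restriction> A) G" using assms by (rule induced_induce)
  then have "digraph (G \<restriction> A)" "sym_digraph (G \<restriction> A)"
    by (rule digraphI_induced, rule induced_graph_imp_graph)
  then show ?thesis
    by (simp add: graph_def pseudo_graph_def digraph_def)
qed

lemma connected_induce_subgraphI:
  assumes "A \<subseteq> verts G" "A \<noteq> {}"
    and cut: "\<And>C D. C \<union> D = A \<Longrightarrow> C \<inter> D = {} \<Longrightarrow>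
      (\<And>u v. u \<in> C \<Longrightarrow> v \<in> D \<Longrightarrow> \<not> u \<rightarrow>\<^bsub>G\<^esub> v) \<Longrightarrow> C = {} \<or> D = {}"
  shows "Digraph_Component.connected (G \<restriction> A)"
proof -
  interpret H: graph "G \<restriction> A" using assms(1) by (rule graph_induce_subgraph)
  have "u \<rightarrow>\<^sup>*\<^bsub>G \<restriction> A\<^esub> v" if u: "u \<in> A" and v: "v \<in> A" for u v
  proof -
    \<comment> \<open>No edge leaves the set of vertices reachable from \<open>u\<close>, so it must
      be all of \<open>A\<close>.\<close>
    let ?C = "{w \<in> A. u \<rightarrow>\<^sup>*\<^bsub>G \<restriction> A\<^esub> w}"
    have "\<not> x \<rightarrow>\<^bsub>G\<^esub> y" if "x \<in> ?C" "y \<in> A - ?C" for x y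
      using that H.reachable_adj_trans[of u x y] by (auto simp: dominates_induce_subgraph_iff)
    then have "?C = {} \<or> A - ?C = {}" by (intro cut) blast+
    moreover have "u \<in> ?C" using u by simp
    ultimately show ?thesis using v by blast
  qed
  then show ?thesis
    unfolding connected_def using assms(2)
    by (intro strongly_connectedI) (auto simp: H.reachable_mk_symmetric_eq[OF H.sym_arcs])
qed

end

theorem theorem1p2:
  fixes G :: "('a, 'b) pre_digraph" and k :: nat
  assumes "graph G"
    and "list_chromatic_number G \<ge> 4 * k + 1"
  shows "\<exists>H. graph H \<and> subgraph H G \<and>
    vertex_connectivity H \<ge> k \<and> list_chromatic_number H \<ge> k"
proof (cases "k = 0")
  case True
  interpret graph G by fact
  show ?thesis using True assms(1) subgraph_refl by auto
next
  case False
  then have kpos: "0 < k" by simp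
  interpret G: graph G by fact
  let ?E = "\<lambda>u v. u \<rightarrow>\<^bsub>G\<^esub> v"
  interpret adjacency ?E by (rule G.adjacency_dominates)
  have "\<not> choosable G (4 * k)"
    using assms(2) not_less_Least[of "4 * k" "choosable G"] by (simp add: list_chromatic_number_def)
  then obtain L :: "'a \<Rightarrow> nat set" where L: "\<forall>v\<in>verts G. finite (L v) \<and> card (L v) = 4 * k"
    and "\<not> (\<exists>c. proper_coloring G c \<and> (\<forall>v\<in>verts G. c v \<in> L v))"
    unfolding choosable_def by blast
  then have "\<not> colorable_from ?E L (verts G)"
    unfolding colorable_from_def proper_coloring_def using G.adj_in_verts by blast
  then obtain V where V: "V \<subseteq> verts G" "\<not> colorable_from ?E L V"
    "\<And>U. U \<subset> V \<Longrightarrow> colorable_from ?E L U"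
    using critical_subset_exists[OF G.finite_verts] by metis
  have finV: "finite V" using V(1) G.finite_verts by (rule finite_subset)
  have LV: "finite (L v) \<and> card (L v) = 4 * k" if "v \<in> V" for v using L V(1) that by blast
  have deg: "4 * k \<le> card (nbrs_in ?E v V)" if "v \<in> V" for v
    using critical_min_degree[OF finV V(2,3) LV that] .
  have "V \<noteq> {}" using V(2) by (auto simp: colorable_from_def)
  then obtain Q U where QU: "U \<subseteq> Q" "Q \<subseteq> V" "U \<noteq> {}" "k < card Q"
    and res: "\<And>u. u \<in> U \<Longrightarrow> card (nbrs_in ?E u (V - U)) \<le> 3 * k"
    and cut: "\<And>S C D. S \<subseteq> Q \<Longrightarrow> card S < k \<Longrightarrow> C \<union> D = Q - S \<Longrightarrow> C \<inter> D = {} \<Longrightarrow>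
      (\<And>u v. u \<in> C \<Longrightarrow> v \<in> D \<Longrightarrow> \<not> ?E u v) \<Longrightarrow> C = {} \<or> D = {}"
    using highly_connected_core_exists[OF finV _ kpos deg] by metis
  let ?H = "G \<restriction> Q"
  have QG: "Q \<subseteq> verts G" using QU(2) V(1) by blast
  have finQ: "finite Q" using QG G.finite_verts by (rule finite_subset)
  have "Digraph_Component.connected (?H \<restriction> (Q - S))" if S: "S \<subseteq> Q" "card S < k" for S
  proof -
    interpret H: graph ?H using QG by (rule G.graph_induce_subgraph)
    have "Q - S \<noteq> {}" using S QU(4) finQ by (metis Diff_eq_empty_iff card_mono finite_subset leD order_less_trans)
    then show ?thesis
    proof (rule H.connected_induce_subgraphI[rotated])
      fix C D assume CD: "C \<union> D = Q - S" "C \<inter> D = {}"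
        and ne: "\<And>u v. u \<in> C \<Longrightarrow> v \<in> D \<Longrightarrow> \<not> u \<rightarrow>\<^bsub>?H\<^esub> v"
      show "C = {} \<or> D = {}"
      proof (rule cut[OF S CD])
        show "\<not> ?E u v" if "u \<in> C" "v \<in> D" for u v
          using ne[OF that] that CD(1) by (auto simp: dominates_induce_subgraph_iff)
      qed
    qed simp
  qed
  then have "vertex_connected ?H k"
    using QU(4) by (simp add: vertex_connected_def)
  \<comment> \<open>Boundedness makes the supremum defining connectivity an upper bound for
    \<open>k\<close>.\<close>
  moreover have "bdd_above {n. vertex_connected ?H n}"
    by (rule bdd_aboveI[of _ "card Q"]) (simp add: vertex_connected_def)
  ultimately have conn: "k \<le> vertex_connectivity ?H"
    unfolding vertex_connectivity_def by (intro cSup_upper) simp_all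
  have "\<not> choosable_on ?E U k"
  proof (rule residual_not_choosable[OF finV _ V(2)])
    show "U \<subseteq> V" using QU by blast
    show "colorable_from ?E L (V - U)" using QU by (intro V(3)) blast
    \<comment> \<open>The lists have \<open>4 * k\<close> colors and at most \<open>3 * k\<close>
      are lost to outside neighbours.\<close>
    show "card (nbrs_in ?E u (V - U)) + k \<le> card (L u)" if "u \<in> U" for u
      using LV[of u] res[OF that] that QU by force
  qed
  then have "\<not> choosable_on ?E Q k" using choosable_on_subset QU(1) by blast
  \<comment> \<open>Choosability from lists of size \<open>n\<close> below \<open>k\<close> would
    carry over to size \<open>k\<close>.\<close>
  then have "k \<le> n" if "choosable ?H n" for n
    using that choosable_on_mono[of ?E Q n k] nat_le_linear[of k n]
    unfolding choosable_induce_subgraph_iff by blast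
  moreover have "choosable ?H (card Q)"
    using choosable_on_card[OF finQ] by (simp add: choosable_induce_subgraph_iff)
  ultimately have "k \<le> list_chromatic_number ?H"
    unfolding list_chromatic_number_def by (metis LeastI)
  moreover have "subgraph ?H G"
    using G.induced_induce[OF QG] by (rule induced_imp_subgraph)
  ultimately show ?thesis using conn G.graph_induce_subgraph[OF QG] by blast
qed

end
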